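(* Let $n\ge1$ and let $f(x,y,z)=u_0+ux+vy+wz$ (with $u_0,u,v,w\in\mathbb{R}$) be a Kähler function on $S^2=\{(x,y,z)\in\mathbb{R}^3\mid x^2+y^2+z^2=1\}$. Then the spectrum $\mathrm{spec}(f)$ and, for each $(x,y,z)\in S^2$, the probability $P_{f,(x,y,z)}$ are well defined (i.e. independent of the decomposition of $f$ used to define them), and $\mathrm{spec}(f)=\{\lambda_0,\dots,\lambda_n\}$, where $$\lambda_k=u_0+\frac2n\,\|(u,v,w)\|\cdot\Big(-\frac n2+k\Big),\qquad k=0,\dots,n,$$ ($\|\cdot\|$ the Euclidean norm), and if $(u,v,w)\neq0$, then $$P_{f,(x,y,z)}(\lambda_k)=\frac1{2^n}\binom nk\Big(1+\frac{ux+vy+wz}{\|(u,v,w)\|}\Big)^k\Big(1-\frac{ux+vy+wz}{\|(u,v,w)\|}\Big)^{n-k}.$$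
   Context: Let $\Omega=\{0,\dots,n\}$ with counting measure. The map $\pi_{\overline{\mathcal{B}}(n,q)}$ sends $(x,y,z)\in S^2$ to the probability on $\Omega$ given by $\pi_{\overline{\mathcal{B}}(n,q)}(x,y,z)(k)=\frac1{2^n}\binom nk(1+x)^k(1-x)^{n-k}$ (with $0^0=1$). $\mathcal{A}_{\mathcal{B}(n,q)}$ is the space of functions $X:\Omega\to\mathbb{R}$ of the form $X(k)=\alpha+\beta k$, $\alpha,\beta\in\mathbb{R}$. The Kähler functions on $S^2$ (with its standard Kähler structure) are exactly the linear combinations of $1,x,y,z$, and each of them can be written as $$f(x,y,z)=\sum_{k=0}^nX(k)\,\big[(\pi_{\overline{\mathcal{B}}(n,q)}\circ\phi)(x,y,z)\big](k),\qquad (x,y,z)\in S^2,$$ with $X\in\mathcal{A}_{\mathcal{B}(n,q)}$ and $\phi\in SO(3)$. For such a decomposition one sets $\mathrm{spec}(f):=\mathrm{Im}(X)\subset\mathbb{R}$ and, for $A\subseteq\mathrm{spec}(f)$, $P_{f,(x,y,z)}(A):=\sum_{k\in X^{-1}(A)}\big[(\pi_{\overline{\mathcal{B}}(n,q)}\circ\phi)(x,y,z)\big](k)$; $P_{f,(x,y,z)}(\lambda)$ means $P_{f,(x,y,z)}(\{\lambda\})$. *)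

theory Defs
  imports "HOL-Analysis.Analysis"
begin

text \<open>
  The sphere \<open>S\<^sup>2\<close> is \<^term>\<open>sphere (0 :: real^3) 1\<close>, a point \<open>(x, y, z)\<close> of it having the coordinates
  \<open>p $ 1\<close>, \<open>p $ 2\<close>, \<open>p $ 3\<close>. The sample space \<open>\<Omega>\<close> is \<^term>\<open>{0..n::nat}\<close>; a function on \<open>\<Omega>\<close> is a function on
  \<^typ>\<open>nat\<close> of which only the values on \<^term>\<open>{0..n::nat}\<close> are ever used. A rotation \<open>\<phi> \<in> SO(3)\<close> is a matrix
  with \<^const>\<open>rotation_matrix\<close>, acting by \<open>\<phi> *v p\<close>.
\<close>

definition binomial_map :: "nat \<Rightarrow> real^3 \<Rightarrow> nat \<Rightarrow> real" where
  "binomial_map n p k = 1 / 2 ^ n * real (n choose k) * (1 + p $ 1) ^ k * (1 - p $ 1) ^ (n - k)"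

definition affine_observables :: "nat \<Rightarrow> (nat \<Rightarrow> real) set" where
  "affine_observables n = {X. \<exists>\<alpha> \<beta>. \<forall>k\<in>{0..n}. X k = \<alpha> + \<beta> * real k}"

definition kaehler_decomposition ::
    "nat \<Rightarrow> (real^3 \<Rightarrow> real) \<Rightarrow> (nat \<Rightarrow> real) \<Rightarrow> real^3^3 \<Rightarrow> bool" where
  "kaehler_decomposition n f X \<phi> \<longleftrightarrow>
     X \<in> affine_observables n \<and> rotation_matrix \<phi> \<and>
     (\<forall>p\<in>sphere 0 1. f p = (\<Sum>k=0..n. X k * binomial_map n (\<phi> *v p) k))"

definition decomposition_spec :: "nat \<Rightarrow> (nat \<Rightarrow> real) \<Rightarrow> real set" where
  "decomposition_spec n X = X ` {0..n}"

definition decomposition_prob ::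
    "nat \<Rightarrow> (nat \<Rightarrow> real) \<Rightarrow> real^3^3 \<Rightarrow> real^3 \<Rightarrow> real set \<Rightarrow> real" where
  "decomposition_prob n X \<phi> p A = (\<Sum>k\<in>{k\<in>{0..n}. X k \<in> A}. binomial_map n (\<phi> *v p) k)"

text \<open>
  The spectrum and the probability of \<open>f\<close> itself are the common values over all decompositions; these
  descriptions denote something meaningful only if a decomposition exists and the value does not
  depend on it.
\<close>

definition kaehler_spec :: "nat \<Rightarrow> (real^3 \<Rightarrow> real) \<Rightarrow> real set" where
  "kaehler_spec n f =
     (THE S. \<exists>X \<phi>. kaehler_decomposition n f X \<phi> \<and> S = decomposition_spec n X)"

definition kaehler_prob :: "nat \<Rightarrow> (real^3 \<Rightarrow> real) \<Rightarrow> real^3 \<Rightarrow> real set \<Rightarrow> real" where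
  "kaehler_prob n f p A =
     (THE r. \<exists>X \<phi>. kaehler_decomposition n f X \<phi> \<and> r = decomposition_prob n X \<phi> p A)"

end

theory Submission
  imports Defs
begin

text \<open>
  Write \<open>c = (u, v, w)\<close>, so that \<open>f p = u0 + c \<bullet> p\<close> on the sphere. Composed with a rotation, the map
  \<^const>\<open>binomial_map\<close> sends \<open>p\<close> to the binomial distribution with success probability
  \<open>(1 + r \<bullet> p) / 2\<close>, where \<open>r\<close> is the first row of the rotation, a unit vector. Since the mean of this
  distribution is \<open>n * (1 + r \<bullet> p) / 2\<close>, a decomposition with \<open>X k = \<alpha> + \<beta> * k\<close> represents the affine
  function with constant term \<open>\<alpha> + n * \<beta> / 2\<close> and gradient \<open>(n * \<beta> / 2) r\<close>. Because the sphere is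
  symmetric about the origin and spans the space, these must be \<open>u0\<close> and \<open>c\<close>.

  The absolute value of \<open>\<beta>\<close> is therefore \<open>2 * norm c / n\<close>, and the only freedom left is the sign of
  \<open>\<beta>\<close>, or the choice of \<open>r\<close> if \<open>c = 0\<close>. For \<open>\<beta> \<ge> 0\<close> the observable is \<open>k \<mapsto> \<lambda>\<^sub>k\<close>. For \<open>\<beta> < 0\<close> it is
  \<open>k \<mapsto> \<lambda>\<^bsub>n-k\<^esub>\<close>, but then \<open>r\<close> is replaced by its opposite, which exchanges success and failure; the
  relabelling \<open>k \<mapsto> n - k\<close> undoes both changes. So every decomposition yields the same spectrum and
  probabilities as the increasing one with some unit vector \<open>e\<close> satisfying \<open>c = norm c *\<^sub>R e\<close>
  (\<open>decomposition_normal_form\<close>). If \<open>c \<noteq> 0\<close> this determines \<open>e\<close>; if \<open>c = 0\<close> all eigenvalues coincide and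
  an event has either the full mass \<open>1\<close> or the mass \<open>0\<close>, whatever \<open>e\<close> is (\<open>binomial_law_unique\<close>).
  Conversely, a rotation with first row \<open>e\<close> exists (\<open>decomposition_exists\<close>).
\<close>

section \<open>Rotated binomial distributions\<close>

text \<open>
  The weights of \<^const>\<open>binomial_map\<close> are the Bernstein polynomials at the success probability
  \<open>(1 + t) / 2\<close>, so the known sums of Bernstein polynomials give the total mass and the mean.
\<close>

lemma Bernstein_half:
  assumes "k \<le> n"
  shows "Bernstein n k ((1 + t) / 2) = 1 / 2 ^ n * real (n choose k) * (1 + t) ^ k * (1 - t) ^ (n - k)"
proof -
  have "1 - (1 + t) / 2 = (1 - t) / 2"
    by (simp add: field_simps)
  then have "Bernstein n k ((1 + t) / 2)
      = real (n choose k) * (1 + t) ^ k * (1 - t) ^ (n - k) / (2 ^ k * 2 ^ (n - k))"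
    unfolding Bernstein_def by (simp only: power_divide) simp
  also have "(2::real) ^ k * 2 ^ (n - k) = 2 ^ n"
    using assms by (simp flip: power_add)
  finally show ?thesis
    by simp
qed

lemma binomial_map_rotated:
  assumes "k \<le> n"
  shows "binomial_map n (\<phi> *v p) k = Bernstein n k ((1 + \<phi> $ 1 \<bullet> p) / 2)"
  using assms by (simp only: Bernstein_half binomial_map_def matrix_vector_mul_component)

lemma Bernstein_reflect:
  assumes "k \<le> n"
  shows "Bernstein n (n - k) (1 - x) = Bernstein n k x"
  using assms by (simp add: Bernstein_def binomial_symmetric[of k n])

lemma affine_observable_mean:
  assumes "\<forall>k\<in>{0..n}. X k = \<alpha> + \<beta> * real k"
  shows "(\<Sum>k=0..n. X k * binomial_map n (\<phi> *v p) k)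
           = (\<alpha> + \<beta> * real n / 2) + (\<beta> * real n / 2) * (\<phi> $ 1 \<bullet> p)"
proof -
  let ?x = "(1 + \<phi> $ 1 \<bullet> p) / 2"
  have "(\<Sum>k=0..n. X k * binomial_map n (\<phi> *v p) k)
          = (\<Sum>k\<le>n. \<alpha> * Bernstein n k ?x + \<beta> * (real k * Bernstein n k ?x))"
    using assms
    by (intro sum.cong) (auto simp: binomial_map_rotated atLeast0AtMost algebra_simps)
  also have "\<dots> = \<alpha> + \<beta> * (real n * ?x)"
    by (simp add: sum.distrib sum_k_Bernstein flip: sum_distrib_left)
  finally show ?thesis
    by (simp add: field_simps)
qed

lemma decomposition_prob_Bernstein:
  "decomposition_prob n X \<phi> p A
     = (\<Sum>k\<in>{k\<in>{0..n}. X k \<in> A}. Bernstein n k ((1 + \<phi> $ 1 \<bullet> p) / 2))"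
  unfolding decomposition_prob_def by (intro sum.cong) (auto simp: binomial_map_rotated)

lemma norm_rotation_row:
  fixes \<phi> :: "real^'n^'n"
  assumes "rotation_matrix \<phi>"
  shows "norm (\<phi> $ i) = 1"
  using assms by (auto simp: rotation_matrix_def orthogonal_matrix_orthonormal_rows row_def)

section \<open>Normal form of a decomposition\<close>

text \<open>
  Averaging over a pair of antipodal points isolates the constant term; the gradients can then be
  compared along each basis vector, all of which lie on the sphere.
\<close>

lemma affine_eq_on_sphere:
  fixes c d :: "'a::euclidean_space"
  assumes "\<And>p. p \<in> sphere 0 1 \<Longrightarrow> a + c \<bullet> p = b + d \<bullet> p"
  shows "a = b" and "c = d"
proof -
  obtain q :: 'a where q: "q \<in> Basis"
    using nonempty_Basis by blast
  show ab: "a = b"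
    using assms[of q] assms[of "- q"] q by simp
  have "c \<bullet> i = d \<bullet> i" if "i \<in> Basis" for i
    using assms[of i] ab that by simp
  then show "c = d"
    by (rule euclidean_eqI)
qed

definition eigenvalue :: "nat \<Rightarrow> real \<Rightarrow> real^3 \<Rightarrow> nat \<Rightarrow> real" where
  "eigenvalue n a c k = a + 2 / real n * norm c * (- (real n / 2) + real k)"

text \<open>
  The law of the eigenvalues at \<open>p\<close> for the increasing observable measured along \<open>e\<close>. The direction is a
  separate argument because \<open>c\<close> determines it only when \<open>c \<noteq> 0\<close>.
\<close>

definition binomial_law :: "nat \<Rightarrow> real \<Rightarrow> real^3 \<Rightarrow> real^3 \<Rightarrow> real^3 \<Rightarrow> real set \<Rightarrow> real" where
  "binomial_law n a c e p A
     = (\<Sum>k\<in>{k\<in>{0..n}. eigenvalue n a c k \<in> A}. Bernstein n k ((1 + e \<bullet> p) / 2))"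

text \<open>
  Comparing coefficients gives \<open>c = (n * \<beta> / 2) r\<close> for the slope \<open>\<beta>\<close> of the observable and the first
  row \<open>r\<close> of the rotation. The unit vector sought is \<open>r\<close> or \<open>- r\<close> according to the sign of \<open>\<beta>\<close>; in
  the second case the success probability \<open>x\<close> becomes \<open>1 - x\<close>, which is compensated by counting failures
  instead of successes.
\<close>

lemma decomposition_normal_form:
  assumes n: "n \<ge> 1"
    and f: "\<And>p. p \<in> sphere 0 1 \<Longrightarrow> f p = a + c \<bullet> p"
    and dec: "kaehler_decomposition n f X \<phi>"
  obtains e where "norm e = 1" "c = norm c *\<^sub>R e"
    "decomposition_spec n X = eigenvalue n a c ` {0..n}"
    "decomposition_prob n X \<phi> = binomial_law n a c e"
proof -
  let ?r = "\<phi> $ 1"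
  obtain \<alpha> \<beta> where X: "\<forall>k\<in>{0..n}. X k = \<alpha> + \<beta> * real k"
    using dec unfolding kaehler_decomposition_def affine_observables_def by blast
  have r: "norm ?r = 1"
    using dec norm_rotation_row unfolding kaehler_decomposition_def by blast
  have "a + c \<bullet> p = (\<alpha> + \<beta> * real n / 2) + ((\<beta> * real n / 2) *\<^sub>R ?r) \<bullet> p"
    if "p \<in> sphere 0 1" for p
    using dec f[OF that] that affine_observable_mean[OF X, of \<phi> p]
    unfolding kaehler_decomposition_def by simp
  note coeffs = affine_eq_on_sphere[OF this]
  have a: "a = \<alpha> + \<beta> * real n / 2" and c: "c = (\<beta> * real n / 2) *\<^sub>R ?r"
    by (rule coeffs; assumption)+
  have N: "norm c = \<bar>\<beta>\<bar> * real n / 2"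
    by (subst c) (simp add: r abs_mult)
  show thesis
  proof (cases "\<beta> \<ge> 0")
    case True
    have Xk: "X k = eigenvalue n a c k" if "k \<in> {0..n}" for k
      using X that N a n True by (simp add: eigenvalue_def field_simps)
    show thesis
    proof (rule that[of ?r])
      show "c = norm c *\<^sub>R ?r"
        using c N True by simp
      show "decomposition_spec n X = eigenvalue n a c ` {0..n}"
        using Xk by (simp add: decomposition_spec_def)
      show "decomposition_prob n X \<phi> = binomial_law n a c ?r"
        unfolding fun_eq_iff decomposition_prob_Bernstein binomial_law_def
        by (auto intro!: sum.cong simp: Xk)
    qed (fact r)
  next
    case False
    have Xk: "X k = eigenvalue n a c (n - k)" if "k \<in> {0..n}" for k
      using X that N a n False by (simp add: eigenvalue_def of_nat_diff field_simps)
    show thesis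
    proof (rule that[of "- ?r"])
      show "norm (- ?r) = 1"
        using r by simp
      show "c = norm c *\<^sub>R - ?r"
        using c N False by simp
      have "decomposition_spec n X = eigenvalue n a c ` (\<lambda>k. n - k) ` {0..n}"
        using Xk by (auto simp: decomposition_spec_def image_image intro!: image_cong)
      also have "(\<lambda>k. n - k) ` {0..n} = {0..n}"
        by (intro bij_betw_imp_surj_on bij_betw_byWitness[where f' = "\<lambda>k. n - k"]) auto
      finally show "decomposition_spec n X = eigenvalue n a c ` {0..n}" .
      show "decomposition_prob n X \<phi> = binomial_law n a c (- ?r)"
      proof (intro ext)
        fix p A
        have reflect: "Bernstein n k ((1 + ?r \<bullet> p) / 2) = Bernstein n (n - k) ((1 + (- ?r) \<bullet> p) / 2)"
          if "k \<le> n" for k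
        proof -
          have "(1 + (- ?r) \<bullet> p) / 2 = 1 - (1 + ?r \<bullet> p) / 2"
            by (simp add: field_simps)
          then show ?thesis
            by (simp only: Bernstein_reflect[OF that])
        qed
        show "decomposition_prob n X \<phi> p A = binomial_law n a c (- ?r) p A"
          unfolding decomposition_prob_Bernstein binomial_law_def
          by (rule sum.reindex_bij_witness[where i = "\<lambda>k. n - k" and j = "\<lambda>k. n - k"])
            (auto simp: Xk reflect)
      qed
    qed
  qed
qed

text \<open>
  The direction \<open>e\<close> is ambiguous only if \<open>c = 0\<close>, when the law is the point mass at \<open>a\<close> for every
  direction.
\<close>

lemma binomial_law_unique:
  assumes "norm e = 1" "c = norm c *\<^sub>R e" "norm e' = 1" "c = norm c *\<^sub>R e'"
  shows "binomial_law n a c e = binomial_law n a c e'"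
proof (cases "c = 0")
  case True
  have "binomial_law n a c d p A = (if a \<in> A then 1 else 0)" for d p A
    using True sum_Bernstein[of n "(1 + d \<bullet> p) / 2"]
    by (simp add: binomial_law_def eigenvalue_def atMost_def)
  then show ?thesis
    by (simp add: fun_eq_iff)
next
  case False
  have "norm c *\<^sub>R e = norm c *\<^sub>R e'"
    using assms(2,4) by simp
  then show ?thesis
    using False by simp
qed

section \<open>Existence of a decomposition\<close>

text \<open>
  Rotations act transitively on the sphere; a rotation carrying the first axis to \<open>e\<close> has first column
  \<open>e\<close>, so its transpose has first row \<open>e\<close>.
\<close>

lemma rotation_with_first_row:
  fixes e :: "real^3"
  assumes "norm e = 1"
  obtains \<phi> :: "real^3^3" where "rotation_matrix \<phi>" "\<phi> $ 1 = e"
proof -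
  obtain B :: "real^3^3" where B: "rotation_matrix B" "B *v axis 1 1 = e"
    using rotation_matrix_exists_basis[of e 1] assms by auto
  show thesis
  proof (rule that[of "transpose B"])
    show "rotation_matrix (transpose B)"
      using B(1) by (simp add: rotation_matrix_def orthogonal_matrix_transpose)
    show "transpose B $ 1 = e"
      using B(2) by (simp add: matrix_vector_mult_basis column_def transpose_def)
  qed
qed

lemma decomposition_exists:
  assumes n: "n \<ge> 1" and f: "\<And>p. p \<in> sphere 0 1 \<Longrightarrow> f p = a + c \<bullet> p"
  shows "\<exists>X \<phi>. kaehler_decomposition n f X \<phi>"
proof -
  obtain e where e: "norm e = 1" "c = norm c *\<^sub>R e"
  proof (cases "c = 0")
    case True
    then show thesis
      using that[of "axis 1 1"] by simp
  next
    case False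
    then show thesis
      using that[of "c /\<^sub>R norm c"] by simp
  qed
  obtain \<phi> :: "real^3^3" where \<phi>: "rotation_matrix \<phi>" "\<phi> $ 1 = e"
    using rotation_with_first_row[OF e(1)] .
  have X: "\<forall>k\<in>{0..n}. eigenvalue n a c k = (a - norm c) + (2 * norm c / real n) * real k"
    using n by (simp add: eigenvalue_def field_simps)
  have "c \<bullet> p = norm c * (e \<bullet> p)" for p
    by (subst e(2)) simp
  then have "f p = (\<Sum>k=0..n. eigenvalue n a c k * binomial_map n (\<phi> *v p) k)"
    if "p \<in> sphere 0 1" for p
    using f[OF that] affine_observable_mean[OF X, of \<phi> p] \<phi>(2) n by simp
  moreover have "eigenvalue n a c \<in> affine_observables n"
    using X unfolding affine_observables_def by blast
  ultimately have "kaehler_decomposition n f (eigenvalue n a c) \<phi>"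
    using \<phi>(1) by (simp add: kaehler_decomposition_def)
  then show ?thesis
    by blast
qed

section \<open>Spectrum and probabilities of a Kaehler function\<close>

lemma binomial_law_singleton:
  assumes "n \<ge> 1" "c \<noteq> 0" "k \<le> n"
  shows "binomial_law n a c (c /\<^sub>R norm c) p {eigenvalue n a c k}
           = 1 / 2 ^ n * real (n choose k) * (1 + (c \<bullet> p) / norm c) ^ k
               * (1 - (c \<bullet> p) / norm c) ^ (n - k)"
proof -
  let ?t = "(c \<bullet> p) / norm c"
  have "{j\<in>{0..n}. eigenvalue n a c j \<in> {eigenvalue n a c k}} = {k}"
    using assms by (auto simp: eigenvalue_def)
  then have "binomial_law n a c (c /\<^sub>R norm c) p {eigenvalue n a c k}
      = Bernstein n k ((1 + (c /\<^sub>R norm c) \<bullet> p) / 2)"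
    unfolding binomial_law_def by simp
  also have "(c /\<^sub>R norm c) \<bullet> p = ?t"
    by (simp only: inner_scaleR_left divide_inverse mult.commute)
  finally show ?thesis
    using Bernstein_half[OF assms(3), of ?t] by simp
qed

theorem proposition9p3:
  fixes n :: nat and u0 u v w :: real and f :: "real^3 \<Rightarrow> real"
  assumes "n \<ge> 1"
    and "\<And>p. p \<in> sphere 0 1 \<Longrightarrow> f p = u0 + u * p $ 1 + v * p $ 2 + w * p $ 3"
  defines "N \<equiv> norm (vector [u, v, w] :: real^3)"
  defines "lam \<equiv> (\<lambda>k::nat. u0 + 2 / real n * N * (- (real n / 2) + real k))"
  shows
    "(\<exists>X \<phi>. kaehler_decomposition n f X \<phi>) \<and>
     (\<forall>X \<phi> X' \<phi>'. kaehler_decomposition n f X \<phi> \<longrightarrow> kaehler_decomposition n f X' \<phi>' \<longrightarrow>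
        decomposition_spec n X = decomposition_spec n X' \<and>
        (\<forall>p\<in>sphere 0 1. \<forall>A\<subseteq>decomposition_spec n X.
           decomposition_prob n X \<phi> p A = decomposition_prob n X' \<phi>' p A)) \<and>
     kaehler_spec n f = lam ` {0..n} \<and>
     ((vector [u, v, w] :: real^3) \<noteq> 0 \<longrightarrow>
        (\<forall>p\<in>sphere 0 1. \<forall>k\<in>{0..n}.
           kaehler_prob n f p {lam k} =
             1 / 2 ^ n * real (n choose k)
               * (1 + (u * p $ 1 + v * p $ 2 + w * p $ 3) / N) ^ k
               * (1 - (u * p $ 1 + v * p $ 2 + w * p $ 3) / N) ^ (n - k)))"
proof -
  define c :: "real^3" where "c = vector [u, v, w]"
  have inner_c: "c \<bullet> p = u * p $ 1 + v * p $ 2 + w * p $ 3" for p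
    by (simp add: c_def inner_vec_def sum_3)
  have f: "f p = u0 + c \<bullet> p" if "p \<in> sphere 0 1" for p
    using assms(2)[OF that] by (simp add: inner_c)
  have lam: "lam = eigenvalue n u0 c"
    by (simp add: lam_def N_def eigenvalue_def c_def fun_eq_iff)
  obtain X0 \<phi>0 where dec0: "kaehler_decomposition n f X0 \<phi>0"
    using decomposition_exists[OF assms(1) f] by blast
  obtain e where e: "norm e = 1" "c = norm c *\<^sub>R e"
    using decomposition_normal_form[OF assms(1) f dec0] by metis
  have canonical: "decomposition_spec n X = lam ` {0..n}"
      "decomposition_prob n X \<phi> = binomial_law n u0 c e"
    if dec: "kaehler_decomposition n f X \<phi>" for X \<phi>
  proof -
    obtain e' where e': "norm e' = 1" "c = norm c *\<^sub>R e'"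
      "decomposition_spec n X = eigenvalue n u0 c ` {0..n}"
      "decomposition_prob n X \<phi> = binomial_law n u0 c e'"
      using decomposition_normal_form[OF assms(1) f dec] by metis
    show "decomposition_spec n X = lam ` {0..n}"
      using e'(3) by (simp add: lam)
    show "decomposition_prob n X \<phi> = binomial_law n u0 c e"
      using e'(4) binomial_law_unique[OF e'(1,2) e] by simp
  qed
  have spec: "kaehler_spec n f = lam ` {0..n}"
    unfolding kaehler_spec_def using dec0 canonical(1) by (intro the_equality) blast+
  have prob: "kaehler_prob n f p A = binomial_law n u0 c e p A" for p A
    unfolding kaehler_prob_def
  proof (rule the_equality)
    show "\<exists>X \<phi>. kaehler_decomposition n f X \<phi> \<and>
        binomial_law n u0 c e p A = decomposition_prob n X \<phi> p A"
      using dec0 canonical(2)[OF dec0] by metis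
  qed (auto simp: canonical(2))
  have law: "kaehler_prob n f p {lam k} =
      1 / 2 ^ n * real (n choose k) * (1 + (c \<bullet> p) / N) ^ k * (1 - (c \<bullet> p) / N) ^ (n - k)"
    if "c \<noteq> 0" "k \<in> {0..n}" for p k
  proof -
    have "binomial_law n u0 c e = binomial_law n u0 c (c /\<^sub>R norm c)"
      by (rule binomial_law_unique[OF e]) (use that in auto)
    then show ?thesis
      using binomial_law_singleton[OF assms(1) that(1), of k u0 p] that
      by (simp add: prob lam N_def c_def)
  qed
  show ?thesis
  proof (intro conjI impI allI ballI)
    show "\<exists>X \<phi>. kaehler_decomposition n f X \<phi>"
      using dec0 by blast
  next
    fix X \<phi> X' \<phi>'
    assume "kaehler_decomposition n f X \<phi>" "kaehler_decomposition n f X' \<phi>'"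
    note canonical[OF this(1)] canonical[OF this(2)]
    then show "decomposition_spec n X = decomposition_spec n X'"
      and "decomposition_prob n X \<phi> p A = decomposition_prob n X' \<phi>' p A" for p A
      by simp_all
  next
    show "kaehler_spec n f = lam ` {0..n}"
      by (fact spec)
  next
    fix p :: "real^3" and k
    assume "(vector [u, v, w] :: real^3) \<noteq> 0" "k \<in> {0..n}"
    then show "kaehler_prob n f p {lam k} =
             1 / 2 ^ n * real (n choose k)
               * (1 + (u * p $ 1 + v * p $ 2 + w * p $ 3) / N) ^ k
               * (1 - (u * p $ 1 + v * p $ 2 + w * p $ 3) / N) ^ (n - k)"
      using law[of k p] unfolding inner_c unfolding c_def by blast
  qed
qed

end
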